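(* Let $K$ be a field, let $\tau:K[y]\otimes K[x]\to K[x]\otimes K[y]$ be a graded twisting map with matrix $M$, and set $\widetilde{M}:=M-Y$. Let $n\in\mathbb{N}$ with $n\ge 2$, take $a,d\in K$ with $(d,a)\neq(1,0)$, set $e:=1-d$, assume that $\widetilde{M}_{j*}=\widetilde{M}_{0*}$ for $j<n$, and that $$d\,\widetilde{M}Y^{n-1}\widetilde{M}=e\,Y^n\widetilde{M}+a\,\widetilde{M}Y^n .$$ For $k\in\mathbb{N}$ let $d_k:=d\sum_{j=0}^{k-1}e^j(-a)^{k-1-j}$. Then $d_k+e^k\neq 0$ for all $k\in\mathbb{N}$, $$\widetilde{M}_{kn,*}=\widetilde{M}_{kn+j,*}\qquad\text{for } k\ge 1 \text{ and } 0<j<n,$$ and, for all $k\in\mathbb{N}$, $$Y^{kn}\widetilde{M}=\sum_{i=0}^k c_{k,i}\,M^{(k-i)n}\,\widetilde{M}\,Y^{in},$$ where $c_{k,0}=d\prod_{i=2}^{k}\frac{d_i}{d_i+e^i}$ and $c_{k,r}=\frac{(-a)^r}{d_r+e^r}\prod_{i=r+1}^{k}\frac{d_i}{d_i+e^i}$ for $1\le r\le k$.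
   Context: $\mathbb{N}=\{1,2,\dots\}$, $\mathbb{N}_0=\mathbb{N}\cup\{0\}$; empty products equal $1$ and $0^0=1$. Tensor products are over $K$; $\mu_{K[x]},\mu_{K[y]}$ denote multiplication. $L(K^{\mathbb{N}_0})$ is the algebra of infinite matrices over $K$ indexed by $\mathbb{N}_0\times\mathbb{N}_0$ with finitely many nonzero entries in each row; $Y$ is the matrix with $Y_{ij}=\delta_{i+1,j}$; $A_{k*}$ is the $k$-th row of $A$. A twisting map is a $K$-linear map $\tau:K[y]\otimes K[x]\to K[x]\otimes K[y]$ such that $\tau(1\otimes f)=f\otimes 1$ and $\tau(y^r\otimes 1)=1\otimes y^r$ for all $f\in K[x]$, $r\ge 0$; $\tau\circ(\mathrm{id}_{K[y]}\otimes\mu_{K[x]})=(\mu_{K[x]}\otimes \mathrm{id}_{K[y]})\circ(\mathrm{id}_{K[x]}\otimes\tau)\circ(\tau\otimes \mathrm{id}_{K[x]})$; and $\tau\circ(\mu_{K[y]}\otimes\mathrm{id}_{K[x]})=(\mathrm{id}_{K[x]}\otimes\mu_{K[y]})\circ(\tau\otimes\mathrm{id}_{K[y]})\circ(\mathrm{id}_{K[y]}\otimes\tau)$. It is graded if $\tau(y^r\otimes x^i)$ lies in the span of $\{x^{r+i-j}\otimes y^j:0\le j\le r+i\}$ for all $r,i$. The matrix of a graded twisting map $\tau$ is the matrix $M\in L(K^{\mathbb{N}_0})$ with $\tau(y^k\otimes x)=\sum_{j=0}^{k+1}M_{kj}\,x^{k+1-j}\otimes y^j$ and $M_{kj}=0$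 for $j>k+1$. A matrix $M\in L(K^{\mathbb{N}_0})$ is the matrix of a (unique) graded twisting map if and only if $M_{0j}=\delta_{0j}$, $M_{kj}=0$ for $j>k+1$, and $Y^kM=\sum_{j=0}^{k+1}M_{kj}M^{k+1-j}Y^j$ for all $k\in\mathbb{N}_0$. *)

theory Defs
  imports Complex_Main "HOL-Library.Poly_Mapping" "HOL-Computational_Algebra.Polynomial"
begin

abbreviation (input) "lookup \<equiv> Poly_Mapping.lookup"
abbreviation (input) "keys \<equiv> Poly_Mapping.keys"

text \<open>The vector space with basis \<open>'i\<close> over the field \<open>'a\<close> is the type \<open>'i \<Rightarrow>\<^sub>0 'a\<close> of finitely
  supported functions. In particular \<open>nat \<Rightarrow>\<^sub>0 'a\<close>, with the convolution product of the library, is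
  the polynomial ring in one variable (see \<open>to_poly\<close> below), used both for \<open>K[x]\<close> and for \<open>K[y]\<close>.\<close>

definition pscale :: "'a::field \<Rightarrow> ('i \<Rightarrow>\<^sub>0 'a) \<Rightarrow> ('i \<Rightarrow>\<^sub>0 'a)" where
  "pscale c = Poly_Mapping.map ((*) c)"

lemma lookup_pscale [simp]: "lookup (pscale c t) i = c * lookup t i"
  unfolding pscale_def by (simp add: map.rep_eq when_def)

interpretation pm: vector_space "pscale :: 'a::field \<Rightarrow> ('i \<Rightarrow>\<^sub>0 'a) \<Rightarrow> _"
  by unfold_locales (auto intro!: poly_mapping_eqI simp: lookup_add algebra_simps)

definition lin_ext :: "('i \<Rightarrow> ('j \<Rightarrow>\<^sub>0 'a::field)) \<Rightarrow> ('i \<Rightarrow>\<^sub>0 'a) \<Rightarrow> ('j \<Rightarrow>\<^sub>0 'a)" where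
  "lin_ext g t = (\<Sum>i\<in>keys t. pscale (lookup t i) (g i))"

lemma lin_ext_superset:
  assumes "finite S" "keys t \<subseteq> S"
  shows "lin_ext g t = (\<Sum>i\<in>S. pscale (lookup t i) (g i))"
  unfolding lin_ext_def
  by (rule sum.mono_neutral_left) (use assms in \<open>auto simp: in_keys_iff\<close>)

lemma lookup_lin_ext: "lookup (lin_ext g t) j = (\<Sum>i\<in>keys t. lookup t i * lookup (g i) j)"
  by (simp add: lin_ext_def lookup_sum)

lemma lin_ext_single [simp]: "lin_ext g (Poly_Mapping.single i c) = pscale c (g i)"
  by (subst lin_ext_superset[of "{i}"]) auto

lemma lin_ext_add: "lin_ext g (s + t) = lin_ext g s + lin_ext g t"
proof -
  let ?S = "keys s \<union> keys t"
  have "keys (s + t) \<subseteq> ?S" by (rule Poly_Mapping.keys_add)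
  then show ?thesis
    by (simp add: lin_ext_superset[of ?S] lookup_add pm.scale_left_distrib sum.distrib)
qed

lemma lin_ext_scale: "lin_ext g (pscale c t) = pscale c (lin_ext g t)"
proof -
  have "keys (pscale c t) \<subseteq> keys t" by (auto simp: in_keys_iff)
  then show ?thesis
    by (simp add: lin_ext_superset[of "keys t"] pm.scale_sum_right)
qed

lemma linear_lin_ext: "Vector_Spaces.linear pscale pscale (lin_ext g)"
  by unfold_locales (auto simp: lin_ext_add lin_ext_scale)

lemma pm_expand: "t = (\<Sum>i\<in>keys t. pscale (lookup t i) (Poly_Mapping.single i 1))"
proof -
  have "lookup (\<Sum>i\<in>keys t. pscale (lookup t i) (Poly_Mapping.single i 1)) k = lookup t k" for k
    by (simp add: lookup_sum lookup_single when_def sum.If_cases in_keys_iff if_distrib cong: if_cong)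
  then show ?thesis by (intro poly_mapping_eqI) simp
qed

lemma linear_expand:
  assumes "Vector_Spaces.linear pscale s h"
  shows "h t = (\<Sum>i\<in>keys t. s (lookup t i) (h (Poly_Mapping.single i 1)))"
proof -
  interpret Vector_Spaces.linear pscale s h by fact
  show ?thesis by (subst pm_expand[of t]) (simp only: sum scale)
qed

lemma linear_eq_lin_ext:
  assumes "Vector_Spaces.linear pscale pscale h"
  shows "h = lin_ext (\<lambda>i. h (Poly_Mapping.single i 1))"
  by (rule ext) (simp add: linear_expand[OF assms, symmetric] lin_ext_def)

lemma lin_ext_lin_ext: "lin_ext h (lin_ext g t) = lin_ext (\<lambda>i. lin_ext h (g i)) t"
proof -
  interpret Vector_Spaces.linear pscale pscale "lin_ext h" by (rule linear_lin_ext)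
  show ?thesis unfolding lin_ext_def[of g] lin_ext_def[of "\<lambda>i. lin_ext h (g i)"]
    by (simp add: sum scale)
qed

lemma lin_ext_id [simp]: "lin_ext (\<lambda>i. Poly_Mapping.single i 1) t = t"
  using pm_expand[of t] by (simp add: lin_ext_def)

text \<open>The tensor product of the spaces with bases \<open>'i\<close> and \<open>'j\<close> is the space with basis
  \<open>'i \<times> 'j\<close>; the lemma \<open>tensor_universal\<close> is its universal property.\<close>

definition tensor :: "('i \<Rightarrow>\<^sub>0 'a::field) \<Rightarrow> ('j \<Rightarrow>\<^sub>0 'a) \<Rightarrow> ('i \<times> 'j \<Rightarrow>\<^sub>0 'a)" where
  "tensor u v = (\<Sum>i\<in>keys u. \<Sum>j\<in>keys v. Poly_Mapping.single (i, j) (lookup u i * lookup v j))"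

definition tensor_map ::
  "(('i \<Rightarrow>\<^sub>0 'a::field) \<Rightarrow> ('k \<Rightarrow>\<^sub>0 'a)) \<Rightarrow> (('j \<Rightarrow>\<^sub>0 'a) \<Rightarrow> ('l \<Rightarrow>\<^sub>0 'a)) \<Rightarrow>
   ('i \<times> 'j \<Rightarrow>\<^sub>0 'a) \<Rightarrow> ('k \<times> 'l \<Rightarrow>\<^sub>0 'a)" where
  "tensor_map f g =
     lin_ext (\<lambda>(i, j). tensor (f (Poly_Mapping.single i 1)) (g (Poly_Mapping.single j 1)))"

definition assoc_r :: "(('i \<times> 'j) \<times> 'k \<Rightarrow>\<^sub>0 'a::field) \<Rightarrow> ('i \<times> ('j \<times> 'k) \<Rightarrow>\<^sub>0 'a)" where
  "assoc_r = lin_ext (\<lambda>((i, j), k). Poly_Mapping.single (i, (j, k)) 1)"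

definition assoc_l :: "('i \<times> ('j \<times> 'k) \<Rightarrow>\<^sub>0 'a::field) \<Rightarrow> (('i \<times> 'j) \<times> 'k \<Rightarrow>\<^sub>0 'a)" where
  "assoc_l = lin_ext (\<lambda>(i, (j, k)). Poly_Mapping.single ((i, j), k) 1)"

lemma lookup_tensor [simp]: "lookup (tensor u v) (i, j) = lookup u i * lookup v j"
proof -
  have "lookup (tensor u v) (i, j) =
      (\<Sum>i'\<in>keys u. \<Sum>j'\<in>keys v. if i' = i then (if j' = j then lookup u i' * lookup v j' else 0) else 0)"
    by (auto simp: tensor_def lookup_sum lookup_single when_def intro!: sum.cong)
  also have "\<dots> = (\<Sum>i'\<in>keys u. if i' = i then (\<Sum>j'\<in>keys v. if j' = j then lookup u i' * lookup v j' else 0) else 0)"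
    by (intro sum.cong) auto
  also have "\<dots> = lookup u i * lookup v j"
    by (simp add: sum.delta in_keys_iff)
  finally show ?thesis .
qed

lemma tensor_single [simp]:
  fixes i :: 'i and j :: 'j and c d :: "'a::field"
  shows "tensor (Poly_Mapping.single i c) (Poly_Mapping.single j d) = Poly_Mapping.single (i, j) (c * d)"
proof (rule poly_mapping_eqI)
  fix p :: "'i \<times> 'j"
  show "lookup (tensor (Poly_Mapping.single i c) (Poly_Mapping.single j d)) p =
      lookup (Poly_Mapping.single (i, j) (c * d)) p"
    by (cases p) (auto simp: lookup_single when_def)
qed

lemma linear_tensor_right: "Vector_Spaces.linear pscale pscale (tensor u)"
  by unfold_locales (auto intro!: poly_mapping_eqI simp: lookup_add algebra_simps)

lemma linear_tensor_left: "Vector_Spaces.linear pscale pscale (\<lambda>u. tensor u v)"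
  by unfold_locales (auto intro!: poly_mapping_eqI simp: lookup_add algebra_simps)

lemma keys_tensor: "keys (tensor u v) = keys u \<times> keys v"
  by (auto simp: in_keys_iff)

lemma tensor_universal:
  fixes b :: "('i \<Rightarrow>\<^sub>0 'a::field) \<Rightarrow> ('j \<Rightarrow>\<^sub>0 'a) \<Rightarrow> 'v::ab_group_add"
  assumes right: "\<And>u. Vector_Spaces.linear pscale s (b u)"
    and left: "\<And>v. Vector_Spaces.linear pscale s (\<lambda>u. b u v)"
  shows "\<exists>!h. Vector_Spaces.linear pscale s h \<and> (\<forall>u v. h (tensor u v) = b u v)"
proof -
  interpret b0: Vector_Spaces.linear pscale s "b 0" by (rule right)
  define h where "h t = (\<Sum>p\<in>keys t. s (lookup t p)
      (b (Poly_Mapping.single (fst p) 1) (Poly_Mapping.single (snd p) 1)))" for t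
  have sup: "h t = (\<Sum>p\<in>S. s (lookup t p)
      (b (Poly_Mapping.single (fst p) 1) (Poly_Mapping.single (snd p) 1)))"
    if "finite S" "keys t \<subseteq> S" for S t
    unfolding h_def
    by (rule sum.mono_neutral_left) (use that in \<open>auto simp: in_keys_iff\<close>)
  have lin: "Vector_Spaces.linear pscale s h"
  proof unfold_locales
    fix t1 t2 :: "'i \<times> 'j \<Rightarrow>\<^sub>0 'a"
    show "h (t1 + t2) = h t1 + h t2"
      using Poly_Mapping.keys_add[of t1 t2]
      by (simp add: sup[of "keys t1 \<union> keys t2"] lookup_add b0.vs2.scale_left_distrib sum.distrib)
  next
    fix c :: 'a and t :: "'i \<times> 'j \<Rightarrow>\<^sub>0 'a"
    have "keys (pscale c t) \<subseteq> keys t" by (auto simp: in_keys_iff)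
    then show "h (pscale c t) = s c (h t)"
      by (simp add: sup[of "keys t"] b0.vs2.scale_sum_right)
  qed
  have ten: "h (tensor u v) = b u v" for u v
  proof -
    have "b u v = (\<Sum>i\<in>keys u. s (lookup u i) (b (Poly_Mapping.single i 1) v))"
      by (rule linear_expand[OF left])
    also have "\<dots> = (\<Sum>i\<in>keys u. s (lookup u i) (\<Sum>j\<in>keys v. s (lookup v j)
        (b (Poly_Mapping.single i 1) (Poly_Mapping.single j 1))))"
      by (intro sum.cong refl arg_cong2[of _ _ _ _ s] linear_expand[OF right])
    also have "\<dots> = (\<Sum>i\<in>keys u. \<Sum>j\<in>keys v. s (lookup u i * lookup v j)
        (b (Poly_Mapping.single i 1) (Poly_Mapping.single j 1)))"
      by (simp add: b0.vs2.scale_sum_right)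
    also have "\<dots> = h (tensor u v)"
      by (simp add: h_def keys_tensor sum.cartesian_product split_beta flip: lookup_tensor)
    finally show ?thesis by simp
  qed
  show ?thesis
  proof (rule ex1I[of _ h])
    show "Vector_Spaces.linear pscale s h \<and> (\<forall>u v. h (tensor u v) = b u v)"
      using lin ten by blast
  next
    fix h' assume h': "Vector_Spaces.linear pscale s h' \<and> (\<forall>u v. h' (tensor u v) = b u v)"
    have eq: "h' (Poly_Mapping.single p 1) =
        b (Poly_Mapping.single (fst p) 1) (Poly_Mapping.single (snd p) 1)" for p
      using h' tensor_single[of "fst p" "1::'a" "snd p" 1] by (metis mult_1 prod.collapse)
    show "h' = h"
    proof
      fix t
      show "h' t = h t"
        using linear_expand[of s h' t] h' by (simp add: h_def eq)
    qed
  qed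
qed

lemma linear_tensor_map: "Vector_Spaces.linear pscale pscale (tensor_map f g)"
  unfolding tensor_map_def by (rule linear_lin_ext)

lemma tensor_map_tensor:
  fixes f :: "('i \<Rightarrow>\<^sub>0 'a::field) \<Rightarrow> ('k \<Rightarrow>\<^sub>0 'a)" and g :: "('j \<Rightarrow>\<^sub>0 'a) \<Rightarrow> ('l \<Rightarrow>\<^sub>0 'a)"
  assumes f: "Vector_Spaces.linear pscale pscale f" and g: "Vector_Spaces.linear pscale pscale g"
  shows "tensor_map f g (tensor u v) = tensor (f u) (g v)"
proof (rule poly_mapping_eqI)
  fix p :: "'k \<times> 'l"
  obtain k l where p: "p = (k, l)" by force
  have "lookup (tensor_map f g (tensor u v)) (k, l) =
     (\<Sum>i\<in>keys u. \<Sum>j\<in>keys v. (lookup u i * lookup (f (Poly_Mapping.single i 1)) k) *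
        (lookup v j * lookup (g (Poly_Mapping.single j 1)) l))"
    by (simp add: tensor_map_def lookup_lin_ext keys_tensor sum.cartesian_product split_beta mult_ac
        flip: sum.cartesian_product)
       (auto simp: sum.cartesian_product split_beta mult_ac intro!: sum.cong)
  also have "\<dots> = lookup (f u) k * lookup (g v) l"
    by (simp add: linear_expand[OF f, of u] linear_expand[OF g, of v] lookup_sum sum_product)
  finally show "lookup (tensor_map f g (tensor u v)) p = lookup (tensor (f u) (g v)) p"
    by (simp add: p)
qed

lemma assoc_r_tensor:
  fixes u :: "'i \<Rightarrow>\<^sub>0 'a::field" and v :: "'j \<Rightarrow>\<^sub>0 'a" and w :: "'k \<Rightarrow>\<^sub>0 'a"
  shows "assoc_r (tensor (tensor u v) w) = tensor u (tensor v w)"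
proof (rule poly_mapping_eqI)
  fix p :: "'i \<times> 'j \<times> 'k"
  obtain i j k where p: "p = (i, (j, k))" by (metis prod.exhaust)
  have "lookup (assoc_r t) (i, (j, k)) = lookup t ((i, j), k)"
    for t :: "('i \<times> 'j) \<times> 'k \<Rightarrow>\<^sub>0 'a"
  proof -
    have "lookup (assoc_r t) (i, (j, k)) = (\<Sum>q\<in>keys t. if q = ((i, j), k) then lookup t q else 0)"
      unfolding assoc_r_def lookup_lin_ext
      by (intro sum.cong refl) (auto simp: lookup_single when_def split: prod.splits)
    then show ?thesis by (simp add: in_keys_iff)
  qed
  then show "lookup (assoc_r (tensor (tensor u v) w)) p = lookup (tensor u (tensor v w)) p"
    by (simp add: p mult_ac)
qed

lemma assoc_l_tensor:
  fixes u :: "'i \<Rightarrow>\<^sub>0 'a::field" and v :: "'j \<Rightarrow>\<^sub>0 'a" and w :: "'k \<Rightarrow>\<^sub>0 'a"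
  shows "assoc_l (tensor u (tensor v w)) = tensor (tensor u v) w"
proof (rule poly_mapping_eqI)
  fix p :: "('i \<times> 'j) \<times> 'k"
  obtain i j k where p: "p = ((i, j), k)" by (metis prod.exhaust)
  have "lookup (assoc_l t) ((i, j), k) = lookup t (i, (j, k))"
    for t :: "'i \<times> 'j \<times> 'k \<Rightarrow>\<^sub>0 'a"
  proof -
    have "lookup (assoc_l t) ((i, j), k) = (\<Sum>q\<in>keys t. if q = (i, (j, k)) then lookup t q else 0)"
      unfolding assoc_l_def lookup_lin_ext
      by (intro sum.cong refl) (auto simp: lookup_single when_def split: prod.splits)
    then show ?thesis by (simp add: in_keys_iff)
  qed
  then show "lookup (assoc_l (tensor u (tensor v w))) p = lookup (tensor (tensor u v) w) p"
    by (simp add: p mult_ac)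
qed

definition pX :: "nat \<Rightarrow>\<^sub>0 'a::field" where
  "pX = Poly_Mapping.single 1 1"

lemma pX_power: "pX ^ r = Poly_Mapping.single r 1"
  by (induction r) (auto simp: pX_def mult_single single_one[symmetric] simp del: single_one)

definition to_poly :: "(nat \<Rightarrow>\<^sub>0 'a::field) \<Rightarrow> 'a poly" where
  "to_poly p = Abs_poly (lookup p)"

lemma coeff_to_poly [simp]: "coeff (to_poly p) n = lookup p n"
proof -
  have "\<forall>\<^sub>\<infinity>i. lookup p i = 0" by (simp add: MOST_iff_cofinite)
  then show ?thesis by (simp add: to_poly_def Abs_poly_inverse)
qed

lemma bij_to_poly: "bij (to_poly :: (nat \<Rightarrow>\<^sub>0 'a::field) \<Rightarrow> 'a poly)"
proof (rule bijI)
  show "inj (to_poly :: _ \<Rightarrow> 'a poly)"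
    by (rule injI) (metis coeff_to_poly poly_mapping_eqI)
  have "\<exists>p. q = to_poly p" for q :: "'a poly"
  proof (rule exI)
    have "finite {i. coeff q i \<noteq> 0}"
      using MOST_coeff_eq_0[of q] by (simp add: MOST_iff_cofinite)
    then show "q = to_poly (Abs_poly_mapping (coeff q))"
      by (intro poly_eqI) simp
  qed
  then show "surj (to_poly :: _ \<Rightarrow> 'a poly)" by (simp add: surj_def)
qed

lemma to_poly_add: "to_poly (p + q) = to_poly p + to_poly q"
  by (rule poly_eqI) (simp add: lookup_add)

lemma to_poly_scale: "to_poly (pscale c p) = smult c (to_poly p)"
  by (rule poly_eqI) simp

lemma to_poly_pX: "to_poly pX = [:0, 1:]"
  by (rule poly_eqI) (auto simp: pX_def lookup_single when_def coeff_pCons split: nat.splits)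

lemma to_poly_mult: "to_poly (p * q) = to_poly p * to_poly q"
proof (rule poly_eqI)
  fix n
  have "lookup (p * q) n = (\<Sum>i\<le>n. lookup p i * lookup q (n - i))"
  proof -
    have *: "Sum_any (\<lambda>j. lookup q j when n = i + j) = (lookup q (n - i) when i \<le> n)" for i
    proof (cases "i \<le> n")
      case True
      then have "(\<lambda>j. lookup q j when n = i + j) = (\<lambda>j. lookup q j when j = n - i)"
        by (auto simp: fun_eq_iff when_def)
      then have "Sum_any (\<lambda>j. lookup q j when n = i + j) = lookup q (n - i)"
        by (simp only: Sum_any_when_equal)
      then show ?thesis using True by simp
    next
      case False
      then have "(\<lambda>j. lookup q j when n = i + j) = (\<lambda>j. 0)"
        by (auto simp: fun_eq_iff when_def)
      then show ?thesis using False by simp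
    qed
    have "lookup (p * q) n = Sum_any (\<lambda>i. lookup p i * (lookup q (n - i) when i \<le> n))"
      unfolding lookup_mult prod_fun_def
      by (simp add: * lookup_mult)
    also have "\<dots> = (\<Sum>i\<le>n. lookup p i * (lookup q (n - i) when i \<le> n))"
      by (rule Sum_any.expand_superset) (auto simp: when_def)
    also have "\<dots> = (\<Sum>i\<le>n. lookup p i * lookup q (n - i))"
      by (rule sum.cong) auto
    finally show ?thesis .
  qed
  then show "coeff (to_poly (p * q)) n = coeff (to_poly p * to_poly q) n"
    by (simp add: coeff_mult)
qed

definition pmu :: "(nat \<times> nat \<Rightarrow>\<^sub>0 'a::field) \<Rightarrow> (nat \<Rightarrow>\<^sub>0 'a)" where
  "pmu = lin_ext (\<lambda>(i, j). pX ^ i * pX ^ j)"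

lemma pmu_tensor: "pmu (tensor f g) = f * g"
proof -
  have lc: "pscale c p = Poly_Mapping.single 0 c * p" for c and p :: "nat \<Rightarrow>\<^sub>0 'a"
    by (simp add: pscale_def mult_map_scale_conv_mult)
  have e: "h = (\<Sum>i\<in>keys h. Poly_Mapping.single 0 (lookup h i) * pX ^ i)" for h :: "nat \<Rightarrow>\<^sub>0 'a"
    using pm_expand[of h] by (simp add: lc pX_power)
  have "f * g = (\<Sum>i\<in>keys f. \<Sum>j\<in>keys g. (Poly_Mapping.single 0 (lookup f i) * pX ^ i) *
      (Poly_Mapping.single 0 (lookup g j) * pX ^ j))"
    by (subst e[of f], subst e[of g]) (simp only: sum_product)
  also have "\<dots> = (\<Sum>i\<in>keys f. \<Sum>j\<in>keys g. pscale (lookup f i * lookup g j) (pX ^ i * pX ^ j))"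
    by (simp add: lc mult_single pX_power)
  also have "\<dots> = pmu (tensor f g)"
    by (simp add: pmu_def lin_ext_def keys_tensor sum.cartesian_product split_beta flip: lookup_tensor)
  finally show ?thesis by simp
qed

text \<open>In \<open>\<tau> :: (nat \<times> nat \<Rightarrow>\<^sub>0 'a) \<Rightarrow> (nat \<times> nat \<Rightarrow>\<^sub>0 'a)\<close> the source is \<open>K[y] \<otimes> K[x]\<close> and the target
  is \<open>K[x] \<otimes> K[y]\<close>, so \<open>(r, i)\<close> stands for \<open>y\<^sup>r \<otimes> x\<^sup>i\<close> in the source, and for \<open>x\<^sup>r \<otimes> y\<^sup>i\<close> in
  the target.\<close>

definition twisting_map :: "((nat \<times> nat \<Rightarrow>\<^sub>0 'a::field) \<Rightarrow> (nat \<times> nat \<Rightarrow>\<^sub>0 'a)) \<Rightarrow> bool" where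
  "twisting_map \<tau> \<longleftrightarrow>
     Vector_Spaces.linear pscale pscale \<tau> \<and>
     (\<forall>f. \<tau> (tensor 1 f) = tensor f 1) \<and>
     (\<forall>r. \<tau> (tensor (pX ^ r) 1) = tensor 1 (pX ^ r)) \<and>
     \<tau> \<circ> tensor_map id pmu =
       tensor_map pmu id \<circ> assoc_l \<circ> tensor_map id \<tau> \<circ> assoc_r \<circ> tensor_map \<tau> id \<circ> assoc_l \<and>
     \<tau> \<circ> tensor_map pmu id =
       tensor_map id pmu \<circ> assoc_r \<circ> tensor_map \<tau> id \<circ> assoc_l \<circ> tensor_map id \<tau> \<circ> assoc_r"

definition graded_twisting_map ::
  "((nat \<times> nat \<Rightarrow>\<^sub>0 'a::field) \<Rightarrow> (nat \<times> nat \<Rightarrow>\<^sub>0 'a)) \<Rightarrow> bool" where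
  "graded_twisting_map \<tau> \<longleftrightarrow> twisting_map \<tau> \<and>
     (\<forall>r i. \<tau> (tensor (pX ^ r) (pX ^ i)) \<in>
        pm.span {tensor (pX ^ (r + i - j)) (pX ^ j) | j. j \<le> r + i})"

text \<open>Matrices with finitely supported rows; \<open>*\<close> is the matrix product and \<open>1\<close> the identity.\<close>

typedef (overloaded) 'a rfmat = "UNIV :: (nat \<Rightarrow> (nat \<Rightarrow>\<^sub>0 'a::field)) set"
  morphisms row of_rows by simp

setup_lifting type_definition_rfmat

definition entry :: "'a::field rfmat \<Rightarrow> nat \<Rightarrow> nat \<Rightarrow> 'a" where
  "entry A i j = lookup (row A i) j"

instantiation rfmat :: (field) ring_1
begin

lift_definition zero_rfmat :: "'a rfmat" is "\<lambda>i. 0" .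
lift_definition one_rfmat :: "'a rfmat" is "\<lambda>i. Poly_Mapping.single i 1" .
lift_definition plus_rfmat :: "'a rfmat \<Rightarrow> 'a rfmat \<Rightarrow> 'a rfmat" is "\<lambda>A B i. A i + B i" .
lift_definition minus_rfmat :: "'a rfmat \<Rightarrow> 'a rfmat \<Rightarrow> 'a rfmat" is "\<lambda>A B i. A i - B i" .
lift_definition uminus_rfmat :: "'a rfmat \<Rightarrow> 'a rfmat" is "\<lambda>A i. - A i" .
lift_definition times_rfmat :: "'a rfmat \<Rightarrow> 'a rfmat \<Rightarrow> 'a rfmat" is "\<lambda>A B i. lin_ext B (A i)" .

instance
proof
  fix A B C :: "'a rfmat"
  show "A * B * C = A * (B * C)" by transfer (simp add: lin_ext_lin_ext)
  show "1 * A = A" by transfer simp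
  show "A * 1 = A" by transfer simp
  show "A + B + C = A + (B + C)" by transfer (simp add: add.assoc)
  show "A + B = B + A" by transfer (simp add: add.commute)
  show "0 + A = A" by transfer simp
  show "- A + A = 0" by transfer simp
  show "A - B = A + - B" by transfer simp
  show "(A + B) * C = A * C + B * C" by transfer (simp add: lin_ext_add)
  show "A * (B + C) = A * B + A * C"
    by transfer (simp add: lin_ext_def pm.scale_right_distrib sum.distrib)
  show "(0::'a rfmat) \<noteq> 1"
    by transfer (metis keys_single keys_zero insert_not_empty zero_neq_one)
qed

end

lemma entry_mult: "entry (A * B) i j = (\<Sum>k\<in>{k. entry A i k \<noteq> 0}. entry A i k * entry B k j)"
  unfolding entry_def by transfer (simp add: lookup_lin_ext keys.rep_eq)

lift_definition mscale :: "'a::field \<Rightarrow> 'a rfmat \<Rightarrow> 'a rfmat" is "\<lambda>c A i. pscale c (A i)" .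

lift_definition matY :: "'a::field rfmat" is "\<lambda>i. Poly_Mapping.single (i + 1) 1" .

definition matrix_of_twisting_map ::
  "((nat \<times> nat \<Rightarrow>\<^sub>0 'a::field) \<Rightarrow> (nat \<times> nat \<Rightarrow>\<^sub>0 'a)) \<Rightarrow> 'a rfmat \<Rightarrow> bool" where
  "matrix_of_twisting_map \<tau> M \<longleftrightarrow>
     (\<forall>k. \<tau> (tensor (pX ^ k) pX) =
        (\<Sum>j=0..k+1. pscale (entry M k j) (tensor (pX ^ (k + 1 - j)) (pX ^ j)))) \<and>
     (\<forall>k j. j > k + 1 \<longrightarrow> entry M k j = 0)"

lemma ex1_matrix_of_twisting_map:
  fixes \<tau> :: "(nat \<times> nat \<Rightarrow>\<^sub>0 'a::field) \<Rightarrow> (nat \<times> nat \<Rightarrow>\<^sub>0 'a)"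
  assumes "graded_twisting_map \<tau>"
  shows "\<exists>!M. matrix_of_twisting_map \<tau> M"
proof -
  define t where "t k = \<tau> (tensor (pX ^ k) pX)" for k
  have pXp: "tensor (pX ^ i) (pX ^ j) = Poly_Mapping.single (i, j) (1::'a)" for i j
    by (simp add: pX_power)
  have supp: "lookup (t k) (i, j) = 0" if "i + j \<noteq> k + 1" for k i j
  proof -
    have "\<tau> (tensor (pX ^ k) (pX ^ 1)) \<in>
        pm.span {tensor (pX ^ (k + 1 - j)) (pX ^ j) | j. j \<le> k + 1}"
      using assms unfolding graded_twisting_map_def by (elim conjE allE)
    then have "t k \<in> pm.span {tensor (pX ^ (k + 1 - j)) (pX ^ j) | j. j \<le> k + 1}"
      unfolding t_def power_one_right .
    moreover have "pm.subspace {u :: nat \<times> nat \<Rightarrow>\<^sub>0 'a. lookup u (i, j) = 0}"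
      by (simp add: pm.subspace_def lookup_add)
    moreover have "{tensor (pX ^ (k + 1 - j)) (pX ^ j) | j. j \<le> k + 1} \<subseteq>
        {u :: nat \<times> nat \<Rightarrow>\<^sub>0 'a. lookup u (i, j) = 0}"
      using that by (auto simp: pXp lookup_single when_def)
    ultimately show ?thesis using pm.span_minimal by blast
  qed
  have sum_lookup: "lookup (\<Sum>j=0..k+1. pscale (c j) (tensor (pX ^ (k + 1 - j)) (pX ^ j))) (i, l) =
      (if i + l = k + 1 then c l else 0)" for c :: "nat \<Rightarrow> 'a" and k i l
  proof -
    have "lookup (\<Sum>j=0..k+1. pscale (c j) (tensor (pX ^ (k + 1 - j)) (pX ^ j))) (i, l) =
        (\<Sum>j=0..k+1. if j = l then (if i + l = k + 1 then c l else 0) else 0)"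
      unfolding lookup_sum lookup_pscale pXp
      by (intro sum.cong refl) (auto simp: lookup_single when_def)
    then show ?thesis by simp
  qed
  define M where "M = of_rows (\<lambda>k. \<Sum>j=0..k+1. Poly_Mapping.single j (lookup (t k) (k + 1 - j, j)))"
  have M: "entry M k j = (if j \<le> k + 1 then lookup (t k) (k + 1 - j, j) else 0)" for k j
  proof -
    have "entry M k j = (\<Sum>l=0..k+1. if l = j then lookup (t k) (k + 1 - l, l) else 0)"
      unfolding entry_def M_def of_rows_inverse[OF UNIV_I] lookup_sum
      by (intro sum.cong refl) (auto simp: lookup_single when_def)
    then show ?thesis by simp
  qed
  have "matrix_of_twisting_map \<tau> M"
    unfolding matrix_of_twisting_map_def t_def[symmetric]
  proof (intro conjI allI impI poly_mapping_eqI)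
    fix k and p :: "nat \<times> nat"
    obtain i l where p: "p = (i, l)" by force
    have "k + 1 - l = i" if "i + l = k + 1" using that by arith
    then show "lookup (t k) p =
        lookup (\<Sum>j=0..k+1. pscale (entry M k j) (tensor (pX ^ (k + 1 - j)) (pX ^ j))) p"
      unfolding p sum_lookup using supp[of i l k] by (auto simp: M)
  qed (simp add: M)
  moreover have "N = N'" if "matrix_of_twisting_map \<tau> N" "matrix_of_twisting_map \<tau> N'" for N N'
  proof -
    have "entry A k j = (if j \<le> k + 1 then lookup (t k) (k + 1 - j, j) else 0)"
      if "matrix_of_twisting_map \<tau> A" for A k j
    proof (cases "j \<le> k + 1")
      case True
      have "t k = (\<Sum>j=0..k+1. pscale (entry A k j) (tensor (pX ^ (k + 1 - j)) (pX ^ j)))"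
        using that unfolding matrix_of_twisting_map_def t_def by blast
      then show ?thesis using True by (simp only: sum_lookup) simp
    next
      case False
      then show ?thesis using that unfolding matrix_of_twisting_map_def by simp
    qed
    then have "entry N = entry N'" using that by (intro ext) simp
    then have "row N = row N'"
      by (intro ext poly_mapping_eqI) (simp add: entry_def fun_eq_iff)
    then show ?thesis by (simp add: row_inject)
  qed
  ultimately show ?thesis by blast
qed

text \<open>The scalars \<open>d\<^sub>k\<close> and \<open>c\<^sub>k\<^sub>,\<^sub>r\<close>, with \<open>e = 1 - d\<close>.\<close>

definition dcoef :: "'a::field \<Rightarrow> 'a \<Rightarrow> nat \<Rightarrow> 'a" where
  "dcoef d a k = d * (\<Sum>j<k. (1 - d) ^ j * (- a) ^ (k - 1 - j))"

definition ccoef :: "'a::field \<Rightarrow> 'a \<Rightarrow> nat \<Rightarrow> nat \<Rightarrow> 'a" where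
  "ccoef d a k r =
     (if r = 0 then d * (\<Prod>i=2..k. dcoef d a i / (dcoef d a i + (1 - d) ^ i))
      else (- a) ^ r / (dcoef d a r + (1 - d) ^ r) *
        (\<Prod>i=r+1..k. dcoef d a i / (dcoef d a i + (1 - d) ^ i)))"

end

theory Submission
  imports Defs
begin

text \<open>
  Write \<open>Y\<close> for the shift matrix and \<open>T = M - Y\<close>. The multiplicativity of the twisting map
  becomes the matrix relation \<open>Y\<^sup>k T = (\<Sum>j. T\<^sub>k\<^sub>j M\<^bsup>k+1-j\<^esup> Y\<^sup>j)\<close>
  (from \<open>twisting_matrix_relation\<close>). The unit condition says that the first row of \<open>T\<close>
  is \<open>(1, -1, 0, \<dots>)\<close>; since the first \<open>n\<close> rows of \<open>T\<close> agree, the relation collapses to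
  \<open>Y\<^sup>k T = M\<^sup>k T\<close> for \<open>k < n\<close>, and comparing consecutive \<open>k\<close> yields \<open>T Y\<^sup>j T = 0\<close>
  for \<open>j < n - 1\<close>. This vanishing, the quadratic relation for \<open>T Y\<^bsup>n-1\<^esup> T\<close> and the first row
  of \<open>M\<close> carry the rest of the proof.

  The quadratic relation allows \<open>T Y\<^bsup>n-1\<^esup> T Y\<^bsup>kn-1\<^esup> T\<close> to be evaluated from the left and from
  the right. Equating the two results and inducting on \<open>k\<close> gives
  (lemma \<open>quadratic_relation_iterated\<close>)
    \<open>d\<^sub>k T Y\<^bsup>kn-1\<^esup> T = e\<^sup>k Y\<^bsup>kn\<^esup> T - (-a)\<^sup>k T Y\<^bsup>kn\<^esup>\<close>,
  where the scalars \<open>d\<^sub>k\<close> enter through \<open>d\<^bsub>k+1\<^esub> = d e\<^sup>k - a d\<^sub>k\<close>. Multiplying this identity by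
  \<open>T Y\<^sup>j\<close> on the left, or by \<open>Y\<^sup>j T\<close> on the right, shows that \<open>T Y\<^bsup>kn+j\<^esup> T\<close> is annihilated by
  both \<open>e\<^sup>k\<close> and \<open>a\<^sup>k\<close>; as \<open>(d, a) \<noteq> (1, 0)\<close> means that \<open>e\<close> and \<open>a\<close> are not both zero, it
  vanishes (lemma \<open>sandwich_eq_0\<close>). Hence \<open>M\<^sup>j Y\<^bsup>kn\<^esup> T = Y\<^bsup>kn+j\<^esup> T\<close> for \<open>j < n\<close>. The first row of
  \<open>M\<close> is the first basis vector, so left multiplication by \<open>M\<close> preserves the first row of a
  matrix; the first row of this equation is the asserted equality of rows of \<open>T\<close>.

  Adding \<open>d\<^sub>k Y\<^bsup>kn\<^esup> T\<close> to the identity turns it into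
    \<open>(d\<^sub>k + e\<^sup>k) Y\<^bsup>kn\<^esup> T = d\<^sub>k M\<^sup>n Y\<^bsup>(k-1)n\<^esup> T + (-a)\<^sup>k T Y\<^bsup>kn\<^esup>\<close>.
  If the scalar on the left vanished, the entry in row \<open>0\<close> and column \<open>kn + 1\<close> would be
  \<open>0 = - (-a)\<^sup>k\<close>; but for \<open>a = 0\<close> the scalar is \<open>e\<^bsup>k-1\<^esup>\<close>, so \<open>e = 0\<close> as well, which is excluded.
  After division the equation is the recursion in \<open>k\<close> whose solution has the coefficients
  \<open>c\<^sub>k\<^sub>,\<^sub>i\<close>.
\<close>

section \<open>Scalar multiples and rows of matrices\<close>

lemma mscale_mult_left: "mscale c A * B = mscale c (A * B)"
  by transfer (simp add: lin_ext_scale)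

lemma mscale_mult_right: "A * mscale c B = mscale c (A * B)"
  by transfer (simp add: lin_ext_def pm.scale_sum_right mult.commute)

interpretation ms: vector_space "mscale :: 'a::field \<Rightarrow> 'a rfmat \<Rightarrow> 'a rfmat"
  by unfold_locales
    (transfer, simp add: pm.scale_right_distrib pm.scale_left_distrib)+

lemma lin_ext_diff: "lin_ext g (s - t) = lin_ext g s - lin_ext g t"
  using lin_ext_add[of g "s - t" t] by (simp add: algebra_simps)

lemma row_add: "row (A + B) k = row A k + row B k"
  by transfer simp

lemma row_diff: "row (A - B) k = row A k - row B k"
  by transfer simp

lemma row_mscale: "row (mscale c A) k = pscale c (row A k)"
  by transfer simp

lemma row_one: "row 1 k = Poly_Mapping.single k 1"
  by transfer simp

lemma row_mult: "row (A * B) k = lin_ext (row B) (row A k)"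
  by transfer simp

lemma row_zero: "row 0 k = 0"
  by transfer simp

lemma row_sum: "row (\<Sum>i\<in>I. f i) k = (\<Sum>i\<in>I. row (f i) k)"
  by (induction I rule: infinite_finite_induct) (simp_all add: row_zero row_add)

lemma row_matY: "row matY k = Poly_Mapping.single (k + 1) 1"
  by transfer simp

lemma row_matY_power: "row (matY ^ r) k = Poly_Mapping.single (k + r) 1"
  by (induction r) (simp_all add: row_one row_mult row_matY power_Suc2 del: power_Suc)

lemma row_matY_power_mult: "row (matY ^ r * A) k = row A (k + r)"
  by (simp add: row_mult row_matY_power)

lemma row_mult_matY_power:
  "row (A * matY ^ r) k = lin_ext (\<lambda>j. Poly_Mapping.single (j + r) 1) (row A k)"
  unfolding row_mult by (rule arg_cong[of _ _ "\<lambda>g. lin_ext g _"]) (simp add: fun_eq_iff row_matY_power)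

lemma rfmat_eqI: "(\<And>k. row A k = row B k) \<Longrightarrow> A = B"
  by (metis row_inject ext)

section \<open>The matrix relation of a twisting map\<close>

text \<open>The specialisation \<open>x = 1\<close> of \<open>K[x] \<otimes> K[y]\<close>. For a graded map the exponent of \<open>x\<close> in
  \<open>\<tau>(y\<^sup>k \<otimes> x\<^sup>i)\<close> is determined by that of \<open>y\<close>, so nothing is lost, and the bookkeeping of
  degrees disappears: multiplication by a power of \<open>x\<close> becomes invisible and multiplication by
  \<open>y\<^sup>p\<close> becomes a shift.\<close>

definition spec_x :: "(nat \<times> nat \<Rightarrow>\<^sub>0 'a::field) \<Rightarrow> (nat \<Rightarrow>\<^sub>0 'a)" where
  "spec_x = lin_ext (\<lambda>(i, j). Poly_Mapping.single j 1)"

lemma tensor_single_left: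
  "tensor (Poly_Mapping.single p 1) t = lin_ext (\<lambda>q. Poly_Mapping.single (p, q) 1) t"
  by (subst linear_eq_lin_ext[OF linear_tensor_right]) simp

lemma tensor_single_right:
  "tensor t (Poly_Mapping.single p 1) = lin_ext (\<lambda>q. Poly_Mapping.single (q, p) 1) t"
  using fun_cong[OF linear_eq_lin_ext[OF linear_tensor_left[of "Poly_Mapping.single p 1"]], of t]
  by simp

lemma pmu_single: "pmu (Poly_Mapping.single (i, j) 1) = Poly_Mapping.single (i + j) 1"
  by (simp add: pmu_def pX_power mult_single)

lemma spec_x_left_mult:
  "spec_x (tensor_map pmu id (assoc_l (tensor (Poly_Mapping.single p 1) t))) = spec_x t"
proof -
  have "spec_x (tensor_map pmu id (assoc_l (Poly_Mapping.single (p, q) 1))) =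
    Poly_Mapping.single (snd q) (1::'a)" for q
    by (cases q) (simp add: spec_x_def tensor_map_def assoc_l_def pmu_single)
  then show ?thesis
    unfolding tensor_single_left spec_x_def tensor_map_def assoc_l_def
    by (simp add: lin_ext_lin_ext case_prod_unfold)
qed

lemma spec_x_right_mult:
  "spec_x (tensor_map id pmu (assoc_r (tensor t (Poly_Mapping.single p 1)))) =
    lin_ext (\<lambda>j. Poly_Mapping.single (j + p) 1) (spec_x t)"
proof -
  have "spec_x (tensor_map id pmu (assoc_r (Poly_Mapping.single (q, p) 1))) =
    Poly_Mapping.single (snd q + p) (1::'a)" for q
    by (cases q) (simp add: spec_x_def tensor_map_def assoc_r_def pmu_single)
  then show ?thesis
    unfolding tensor_single_right spec_x_def tensor_map_def assoc_r_def
    by (simp add: lin_ext_lin_ext case_prod_unfold)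
qed

lemma matrix_expansion:
  assumes "matrix_of_twisting_map \<tau> M"
  shows "\<tau> (Poly_Mapping.single (k, 1) 1) =
    lin_ext (\<lambda>j. Poly_Mapping.single (k + 1 - j, j) 1) (row M k)"
proof -
  have "keys (row M k) \<subseteq> {0..k+1}"
    using assms by (force simp: matrix_of_twisting_map_def entry_def in_keys_iff not_le[symmetric])
  then have "lin_ext (\<lambda>j. Poly_Mapping.single (k + 1 - j, j) 1) (row M k) =
    (\<Sum>j=0..k+1. pscale (entry M k j) (Poly_Mapping.single (k + 1 - j, j) 1))"
    by (simp add: lin_ext_superset[of "{0..k+1}"] entry_def)
  moreover have "\<tau> (tensor (pX ^ k) pX) =
        (\<Sum>j=0..k+1. pscale (entry M k j) (tensor (pX ^ (k + 1 - j)) (pX ^ j)))"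
    using assms unfolding matrix_of_twisting_map_def by blast
  ultimately show ?thesis by (simp add: pX_power) (simp add: pX_def)
qed

text \<open>Multiplicativity in \<open>K[x]\<close>: moving \<open>y\<^sup>k\<close> past \<open>x\<close> gives \<open>\<Sum>j. M\<^sub>k\<^sub>j x\<^bsup>k+1-j\<^esup> y\<^sup>j\<close>, and each
  \<open>y\<^sup>j\<close> still has to move past \<open>x\<^sup>i\<close>. After \<open>x = 1\<close> this is the \<open>k\<close>-th row of the product
  \<open>M * M\<^sup>i\<close>.\<close>

lemma row_matrix_power:
  assumes tw: "twisting_map \<tau>" and M: "matrix_of_twisting_map \<tau> M"
  shows "spec_x (\<tau> (Poly_Mapping.single (k, i) 1)) = row (M ^ i) k"
proof (induction i arbitrary: k)
  case 0
  have "\<tau> (tensor (pX ^ k) 1) = tensor 1 (pX ^ k)"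
    using tw by (simp add: twisting_map_def)
  then have "\<tau> (Poly_Mapping.single (k, 0) 1) = Poly_Mapping.single (0, k) 1"
    by (simp add: pX_power flip: single_one)
  then show ?case by (simp add: spec_x_def row_one)
next
  case (Suc i)
  have "\<tau> (Poly_Mapping.single (k, Suc i) 1) =
    (\<tau> \<circ> tensor_map id pmu) (Poly_Mapping.single (k, (1, i)) 1)"
    by (simp add: tensor_map_def pmu_single)
  also have "\<dots> = (tensor_map pmu id \<circ> assoc_l \<circ> tensor_map id \<tau> \<circ> assoc_r \<circ> tensor_map \<tau> id \<circ> assoc_l)
      (Poly_Mapping.single (k, (1, i)) 1)"
    using tw by (simp add: twisting_map_def)
  also have "\<dots> = tensor_map pmu id (assoc_l (tensor_map id \<tau> (assoc_r
      (tensor (\<tau> (Poly_Mapping.single (k, 1) 1)) (Poly_Mapping.single i 1)))))"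
    by (simp add: tensor_map_def[of \<tau>] assoc_l_def[where 'a='a and 'i=nat and 'j=nat and 'k=nat])
  also have "\<dots> = tensor_map pmu id (assoc_l (lin_ext (\<lambda>j. tensor (Poly_Mapping.single (k + 1 - j) 1)
      (\<tau> (Poly_Mapping.single (j, i) 1))) (row M k)))"
    by (simp add: matrix_expansion[OF M] tensor_single_right lin_ext_lin_ext assoc_r_def
      tensor_map_def[of id] del: One_nat_def)
  also have "\<dots> = lin_ext (\<lambda>j. tensor_map pmu id (assoc_l (tensor (Poly_Mapping.single (k + 1 - j) 1)
      (\<tau> (Poly_Mapping.single (j, i) 1))))) (row M k)"
    by (simp add: tensor_map_def assoc_l_def lin_ext_lin_ext)
  finally have "spec_x (\<tau> (Poly_Mapping.single (k, Suc i) 1)) =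
     lin_ext (\<lambda>j. spec_x (tensor_map pmu id (assoc_l (tensor (Poly_Mapping.single (k + 1 - j) 1)
      (\<tau> (Poly_Mapping.single (j, i) 1)))))) (row M k)"
    by (simp add: spec_x_def lin_ext_lin_ext)
  then show ?case
    by (simp add: spec_x_left_mult Suc.IH row_mult)
qed

text \<open>Multiplicativity in \<open>K[y]\<close>, applied to \<open>y\<^sup>l y\<^sup>k \<otimes> x\<close>: the factor \<open>y\<^sup>k\<close> passes \<open>x\<close> and
  produces the terms \<open>M\<^sub>k\<^sub>j x\<^bsup>k+1-j\<^esup> y\<^sup>j\<close>; then \<open>y\<^sup>l\<close> passes \<open>x\<^bsup>k+1-j\<^esup>\<close>, which is the \<open>l\<close>-th row
  of \<open>M\<^bsup>k+1-j\<^esup>\<close>, and the trailing \<open>y\<^sup>j\<close> is the factor \<open>Y\<^sup>j\<close>. The left hand side is row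
  \<open>l + k\<close> of \<open>M\<close>, that is, row \<open>l\<close> of \<open>Y\<^sup>k M\<close>.\<close>

theorem twisting_matrix_relation:
  assumes tw: "twisting_map \<tau>" and M: "matrix_of_twisting_map \<tau> M"
  shows "matY ^ k * M = (\<Sum>j\<le>k+1. mscale (entry M k j) (M ^ (k + 1 - j) * matY ^ j))"
proof (rule rfmat_eqI)
  fix l
  have keys: "keys (row M k) \<subseteq> {..k+1}"
    using M by (force simp: matrix_of_twisting_map_def entry_def in_keys_iff not_le[symmetric])
  have "\<tau> (Poly_Mapping.single (l + k, 1) 1) =
    (\<tau> \<circ> tensor_map pmu id) (Poly_Mapping.single ((l, k), 1) 1)"
    by (simp add: tensor_map_def pmu_single)
  also have "\<dots> = (tensor_map id pmu \<circ> assoc_r \<circ> tensor_map \<tau> id \<circ> assoc_l \<circ> tensor_map id \<tau> \<circ> assoc_r)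
      (Poly_Mapping.single ((l, k), 1) 1)"
    using tw by (simp add: twisting_map_def)
  also have "\<dots> = tensor_map id pmu (assoc_r (tensor_map \<tau> id (assoc_l
      (tensor (Poly_Mapping.single l 1) (\<tau> (Poly_Mapping.single (k, 1) 1))))))"
    by (simp add: tensor_map_def[of _ \<tau>] assoc_r_def[where 'a='a and 'i=nat and 'j=nat and 'k=nat])
  also have "\<dots> = tensor_map id pmu (assoc_r (lin_ext (\<lambda>j. tensor
      (\<tau> (Poly_Mapping.single (l, k + 1 - j) 1)) (Poly_Mapping.single j 1)) (row M k)))"
    by (simp add: matrix_expansion[OF M] tensor_single_left lin_ext_lin_ext assoc_l_def
      tensor_map_def[of _ id] del: One_nat_def)
  also have "\<dots> = lin_ext (\<lambda>j. tensor_map id pmu (assoc_r (tensor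
      (\<tau> (Poly_Mapping.single (l, k + 1 - j) 1)) (Poly_Mapping.single j 1)))) (row M k)"
    by (simp add: tensor_map_def assoc_r_def lin_ext_lin_ext)
  finally have "spec_x (\<tau> (Poly_Mapping.single (l + k, 1) 1)) =
    lin_ext (\<lambda>j. spec_x (tensor_map id pmu (assoc_r (tensor
      (\<tau> (Poly_Mapping.single (l, k + 1 - j) 1)) (Poly_Mapping.single j 1))))) (row M k)"
    by (simp add: spec_x_def lin_ext_lin_ext)
  then have "row M (l + k) = lin_ext (\<lambda>j. row (M ^ (k + 1 - j) * matY ^ j) l) (row M k)"
    by (simp only: spec_x_right_mult row_matrix_power[OF tw M] row_mult_matY_power power_one_right)
  also have "\<dots> = (\<Sum>j\<le>k+1. pscale (entry M k j) (row (M ^ (k + 1 - j) * matY ^ j) l))"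
    by (simp only: lin_ext_superset[OF finite_atMost keys] entry_def)
  finally show "row (matY ^ k * M) l = row (\<Sum>j\<le>k+1. mscale (entry M k j) (M ^ (k + 1 - j) * matY ^ j)) l"
    by (simp only: row_sum row_mscale row_matY_power_mult)
qed

lemma twisting_matrix_row_0:
  assumes tw: "twisting_map \<tau>" and M: "matrix_of_twisting_map \<tau> M"
  shows "row M 0 = Poly_Mapping.single 0 1"
proof -
  have "\<tau> (tensor 1 pX) = tensor pX 1"
    using tw by (simp add: twisting_map_def)
  then have "\<tau> (Poly_Mapping.single (0, 1) 1) = Poly_Mapping.single (1, 0) 1"
    by (simp add: pX_def flip: single_one)
  then show ?thesis
    using row_matrix_power[OF tw M, of 0 1] by (simp add: spec_x_def)
qed

section \<open>Consequences of the quadratic relation\<close>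

lemma dcoef_1: "dcoef d a 1 = d"
  by (simp add: dcoef_def)

lemma dcoef_Suc: "dcoef d a (Suc k) = d * (1 - d) ^ k - a * dcoef d a k"
proof -
  have diff: "k - j = Suc (k - 1 - j)" if "j < k" for j
    using that by simp
  have "(\<Sum>j<k. (1 - d) ^ j * (- a) ^ (k - j)) = (\<Sum>j<k. - a * ((1 - d) ^ j * (- a) ^ (k - 1 - j)))"
    by (intro sum.cong refl) (simp add: diff)
  also have "\<dots> = - a * (\<Sum>j<k. (1 - d) ^ j * (- a) ^ (k - 1 - j))"
    by (simp only: sum_distrib_left)
  finally show ?thesis by (simp add: dcoef_def algebra_simps)
qed

text \<open>In the induction step \<open>P = T Y\<^bsup>n-1\<^esup> T Y\<^bsup>kn-1\<^esup> T\<close> is evaluated twice: the given relation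
  rewrites its left half, the induction hypothesis its right half. Both results contain
  \<open>X = T Y\<^bsup>(k+1)n-1\<^esup> T\<close>, and the mixed term \<open>Z = Y\<^sup>n T Y\<^bsup>kn\<^esup>\<close> occurs in both with the same
  coefficient, so it cancels in \<open>d d\<^sub>k P\<close>. What remains is the relation for \<open>k + 1\<close>, with the
  coefficient \<open>d e\<^sup>k - a d\<^sub>k = d\<^bsub>k+1\<^esub>\<close> in front of \<open>X\<close>.\<close>

lemma quadratic_relation_iterated:
  fixes T Y :: "'a::field rfmat"
  assumes rel: "mscale d (T * Y ^ (n - 1) * T) = mscale (1 - d) (Y ^ n * T) + mscale a (T * Y ^ n)"
    and n: "n \<ge> 1" and k: "k \<ge> 1"
  shows "mscale (dcoef d a k) (T * Y ^ (k * n - 1) * T) =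
    mscale ((1 - d) ^ k) (Y ^ (k * n) * T) - mscale ((- a) ^ k) (T * Y ^ (k * n))"
  using k
proof (induction k rule: nat_induct_at_least)
  case base
  then show ?case using rel by (simp add: dcoef_1[simplified])
next
  case (Suc k)
  define e D where "e = 1 - d" and "D = dcoef d a k"
  define X where "X = T * Y ^ (Suc k * n - 1) * T"
  define Z where "Z = Y ^ n * T * Y ^ (k * n)"
  define U where "U = Y ^ (Suc k * n) * T"
  define V where "V = T * Y ^ (Suc k * n)"
  define P where "P = T * Y ^ (n - 1) * T * Y ^ (k * n - 1) * T"
  have ge: "k * n \<ge> 1" using n Suc.hyps by simp
  have X1: "T * Y ^ n * (Y ^ (k * n - 1) * T) = X"
    using ge by (simp add: X_def mult.assoc flip: power_add mult.assoc[of "Y ^ _" "Y ^ _"])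
  have X2: "T * Y ^ (n - 1) * (Y ^ (k * n) * T) = X"
    using n by (simp add: X_def mult.assoc add.commute flip: power_add mult.assoc[of "Y ^ _" "Y ^ _"])
  have U: "Y ^ n * (Y ^ (k * n) * T) = U"
    by (simp add: U_def power_add mult.assoc)
  have V: "T * Y ^ n * Y ^ (k * n) = V"
    by (simp add: V_def power_add mult.assoc)
  have IH: "mscale D (T * Y ^ (k * n - 1) * T) = mscale (e ^ k) (Y ^ (k * n) * T) - mscale ((- a) ^ k) (T * Y ^ (k * n))"
    using Suc.IH by (simp add: D_def e_def)
  have "mscale d P = mscale d (T * Y ^ (n - 1) * T) * (Y ^ (k * n - 1) * T)"
    by (simp add: P_def mscale_mult_left mult.assoc)
  also have "\<dots> = mscale e (Y ^ n * (T * Y ^ (k * n - 1) * T)) + mscale a X"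
    by (simp only: rel e_def distrib_right mscale_mult_left X1) (simp add: mult.assoc)
  finally have "mscale d P = mscale e (Y ^ n * (T * Y ^ (k * n - 1) * T)) + mscale a X" .
  then have "mscale D (mscale d P) =
      mscale e (Y ^ n * mscale D (T * Y ^ (k * n - 1) * T)) + mscale (a * D) X"
    by (simp add: ms.scale_right_distrib mscale_mult_right ms.scale_left_commute mult.commute)
  also have "mscale e (Y ^ n * mscale D (T * Y ^ (k * n - 1) * T)) =
      mscale (e ^ Suc k) U - mscale (e * (- a) ^ k) Z"
    unfolding IH
    by (simp only: right_diff_distrib ms.scale_right_diff_distrib mscale_mult_right U
        Z_def mult.assoc ms.scale_scale power_Suc)
  finally have 1: "mscale D (mscale d P) =
      mscale (e ^ Suc k) U - mscale (e * (- a) ^ k) Z + mscale (a * D) X" .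
  have "mscale D P = T * Y ^ (n - 1) * mscale D (T * Y ^ (k * n - 1) * T)"
    by (simp add: P_def mscale_mult_right mult.assoc)
  also have "\<dots> = mscale (e ^ k) X - mscale ((- a) ^ k) (T * Y ^ (n - 1) * T * Y ^ (k * n))"
    unfolding IH
    by (simp only: right_diff_distrib mscale_mult_right X2 mult.assoc[of _ T])
  finally have "mscale d (mscale D P) =
     mscale (d * e ^ k) X - mscale ((- a) ^ k) (mscale d (T * Y ^ (n - 1) * T) * Y ^ (k * n))"
    by (simp add: ms.scale_right_diff_distrib mscale_mult_left mult.commute)
  also have "\<dots> = mscale (d * e ^ k) X - mscale (e * (- a) ^ k) Z + mscale ((- a) ^ Suc k) V"
    by (simp only: rel distrib_right mscale_mult_left V ms.scale_right_distrib ms.scale_scale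
        flip: e_def Z_def) (simp add: algebra_simps)
  finally have "mscale (d * e ^ k) X - mscale (a * D) X = mscale (e ^ Suc k) U - mscale ((- a) ^ Suc k) V"
    using 1 by (simp add: ms.scale_left_commute[of d D] algebra_simps del: power_Suc)
  then show ?case
    by (simp only: dcoef_Suc ms.scale_left_diff_distrib X_def U_def V_def D_def e_def)
qed

text \<open>Multiplying the iterated relation by \<open>T Y\<^sup>j\<close> from the left kills every term except
  \<open>e\<^sup>k T Y\<^bsup>kn+j\<^esup> T\<close>; multiplying it by \<open>Y\<^sup>j T\<close> from the right kills every term except
  \<open>(-a)\<^sup>k T Y\<^bsup>kn+j\<^esup> T\<close>. At least one of the two scalars is nonzero.\<close>

lemma sandwich_eq_0:
  fixes T Y :: "'a::field rfmat"
  assumes rel: "mscale d (T * Y ^ (n - 1) * T) = mscale (1 - d) (Y ^ n * T) + mscale a (T * Y ^ n)"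
    and da: "(d, a) \<noteq> (1, 0)"
    and zero: "\<And>j. j + 1 < n \<Longrightarrow> T * Y ^ j * T = 0"
    and j: "j + 1 < n"
  shows "T * Y ^ (k * n + j) * T = 0"
proof (cases "k = 0")
  case True
  then show ?thesis using zero[OF j] by simp
next
  case False
  define e X where "e = 1 - d" and "X = T * Y ^ (k * n + j) * T"
  have it: "mscale (dcoef d a k) (T * Y ^ (k * n - 1) * T) =
    mscale (e ^ k) (Y ^ (k * n) * T) - mscale ((- a) ^ k) (T * Y ^ (k * n))"
    unfolding e_def by (rule quadratic_relation_iterated[OF rel]) (use False j in auto)
  have "T * Y ^ j * mscale (dcoef d a k) (T * Y ^ (k * n - 1) * T) =
      mscale (dcoef d a k) (T * Y ^ j * T * (Y ^ (k * n - 1) * T))"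
    by (simp only: mscale_mult_right mult.assoc)
  also have "\<dots> = 0" by (simp add: zero[OF j])
  finally have "mscale (e ^ k) (T * Y ^ j * (Y ^ (k * n) * T)) =
      mscale ((- a) ^ k) (T * Y ^ j * (T * Y ^ (k * n)))"
    by (simp only: it right_diff_distrib mscale_mult_right right_minus_eq)
  then have "mscale (e ^ k) (T * Y ^ j * (Y ^ (k * n) * T)) =
      mscale ((- a) ^ k) (T * Y ^ j * T * Y ^ (k * n))"
    by (simp only: mult.assoc)
  moreover have "T * Y ^ j * (Y ^ (k * n) * T) = X"
    by (simp add: X_def add.commute[of _ j] power_add mult.assoc)
  ultimately have eX: "mscale (e ^ k) X = 0" by (simp add: zero[OF j])
  have "mscale (dcoef d a k) (T * Y ^ (k * n - 1) * T) * (Y ^ j * T) =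
      mscale (dcoef d a k) (T * Y ^ (k * n - 1) * (T * Y ^ j * T))"
    by (simp only: mscale_mult_left mult.assoc)
  also have "\<dots> = 0" by (simp add: zero[OF j])
  finally have "mscale (e ^ k) (Y ^ (k * n) * T * (Y ^ j * T)) =
      mscale ((- a) ^ k) (T * Y ^ (k * n) * (Y ^ j * T))"
    by (simp only: it left_diff_distrib mscale_mult_left right_minus_eq)
  then have "mscale ((- a) ^ k) (T * Y ^ (k * n) * (Y ^ j * T)) =
      mscale (e ^ k) (Y ^ (k * n) * (T * Y ^ j * T))"
    by (simp only: mult.assoc)
  moreover have "T * Y ^ (k * n) * (Y ^ j * T) = X"
    by (simp add: X_def power_add mult.assoc)
  ultimately have aX: "mscale ((- a) ^ k) X = 0" by (simp add: zero[OF j])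
  have "e \<noteq> 0 \<or> a \<noteq> 0" using da by (auto simp: e_def)
  then show ?thesis using eX aX by (auto simp: X_def)
qed

section \<open>Powers of the shift times the reduced matrix\<close>

text \<open>For such a row only the terms \<open>j = 0, 1, k + 1\<close> survive in the matrix relation, and
  \<open>M\<^bsup>k+1\<^esup> - M\<^sup>k Y = M\<^sup>k (M - Y)\<close>.\<close>

lemma shift_mult_eq_power_mult:
  assumes tw: "twisting_map \<tau>" and M: "matrix_of_twisting_map \<tau> M"
    and row: "row M k = Poly_Mapping.single 0 1 - Poly_Mapping.single 1 1 + Poly_Mapping.single (k + 1) 1"
  shows "matY ^ k * (M - matY) = M ^ k * (M - matY)"
proof -
  have ent: "entry M k j = (if j = 0 then 1 else 0) - (if j = 1 then 1 else 0)
      + (if j = k + 1 then 1 else 0)" for j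
    by (auto simp: entry_def row lookup_add lookup_minus lookup_single when_def
        simp del: single_one)
  have "matY ^ k * M = (\<Sum>j\<le>k+1. (if j = 0 then M ^ (k + 1 - j) * matY ^ j else 0)
     - (if j = 1 then M ^ (k + 1 - j) * matY ^ j else 0)
     + (if j = k + 1 then M ^ (k + 1 - j) * matY ^ j else 0))"
    unfolding twisting_matrix_relation[OF tw M]
    by (intro sum.cong refl) (simp add: ent ms.scale_left_distrib ms.scale_left_diff_distrib)
  also have "\<dots> = M ^ (k + 1) - M ^ k * matY + matY ^ (k + 1)"
    by (simp add: sum.distrib sum_subtractf)
  finally show ?thesis by (simp add: right_diff_distrib power_Suc2 del: power_Suc)
qed

text \<open>Each factor \<open>Y + T\<close> acts like \<open>Y\<close> because its part \<open>T\<close> annihilates what follows.\<close>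

lemma sum_power_mult_eq_power_mult:
  fixes T Y :: "'a::ring_1"
  assumes "\<And>i. i < j \<Longrightarrow> T * Y ^ (m + i) * T = 0"
  shows "(Y + T) ^ j * (Y ^ m * T) = Y ^ (m + j) * T"
  using assms
proof (induction j)
  case (Suc j)
  have "(Y + T) ^ Suc j * (Y ^ m * T) = (Y + T) * (Y ^ (m + j) * T)"
    using Suc by (simp add: mult.assoc)
  also have "\<dots> = Y ^ (m + Suc j) * T"
    using Suc.prems[of j] by (simp add: distrib_right mult.assoc)
  finally show ?case .
qed simp

theorem theorem5p3:
  fixes \<tau> :: "(nat \<times> nat \<Rightarrow>\<^sub>0 'a::field) \<Rightarrow> (nat \<times> nat \<Rightarrow>\<^sub>0 'a)"
    and M Mt :: "'a rfmat" and n :: nat and a d e :: 'a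
  assumes "graded_twisting_map \<tau>" and "matrix_of_twisting_map \<tau> M"
    and "Mt = M - matY"
    and "n \<ge> 2" and "(d, a) \<noteq> (1, 0)" and "e = 1 - d"
    and "\<forall>j<n. row Mt j = row Mt 0"
    and "mscale d (Mt * matY ^ (n - 1) * Mt) = mscale e (matY ^ n * Mt) + mscale a (Mt * matY ^ n)"
  shows "(\<forall>k\<ge>1. dcoef d a k + e ^ k \<noteq> 0) \<and>
    (\<forall>k\<ge>1. \<forall>j. 0 < j \<and> j < n \<longrightarrow> row Mt (k * n) = row Mt (k * n + j)) \<and>
    (\<forall>k\<ge>1. matY ^ (k * n) * Mt =
       (\<Sum>i=0..k. mscale (ccoef d a k i) (M ^ ((k - i) * n) * Mt * matY ^ (i * n))))"
proof -
  have tw: "twisting_map \<tau>" using assms(1) by (simp add: graded_twisting_map_def)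
  note M = assms(2) and n = assms(4) and e = assms(6)
  have M_eq: "M = matY + Mt" using assms(3) by simp
  note rel = assms(8)[unfolded e]
  have row_M0: "row M 0 = Poly_Mapping.single 0 1"
    by (rule twisting_matrix_row_0[OF tw M])
  \<comment> \<open>Taking row 0 will turn matrix identities into identities between rows of \<open>Mt\<close>.\<close>
  have row_M0_mult: "row (M ^ j * A) 0 = row A 0" for j A
    by (induction j) (simp_all add: mult.assoc row_mult[of M] row_M0 del: single_one)
  have row_T0: "row Mt 0 = Poly_Mapping.single 0 1 - Poly_Mapping.single 1 1"
    by (simp add: assms(3) row_diff row_M0 row_matY)
  have comm: "matY ^ k * Mt = M ^ k * Mt" if "k < n" for k
  proof -
    have "row Mt k = row Mt 0" using assms(7) that by blast
    then have "row M k = Poly_Mapping.single 0 1 - Poly_Mapping.single 1 1 + Poly_Mapping.single (k + 1) 1"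
      by (simp add: M_eq row_add row_T0 row_matY)
    then show ?thesis using shift_mult_eq_power_mult[OF tw M] assms(3) by blast
  qed
  \<comment> \<open>\<open>M (Y\<^sup>j T)\<close> and \<open>Y (Y\<^sup>j T)\<close> agree, so their difference \<open>T Y\<^sup>j T\<close> vanishes.\<close>
  have zero: "Mt * matY ^ j * Mt = 0" if "j + 1 < n" for j
  proof -
    have "matY ^ Suc j * Mt = M * (M ^ j * Mt)"
      using comm[of "Suc j"] that by (simp add: mult.assoc)
    also have "\<dots> = (matY + Mt) * (matY ^ j * Mt)"
      using comm[of j] that M_eq by simp
    finally show ?thesis by (simp add: distrib_right mult.assoc)
  qed
  have sandwich: "Mt * matY ^ (k * n + j) * Mt = 0" if "j + 1 < n" for k j
    by (rule sandwich_eq_0[OF rel assms(5) zero that])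
  have shift: "M ^ j * (matY ^ (k * n) * Mt) = matY ^ (k * n + j) * Mt" if "j < n" for k j
    unfolding M_eq by (rule sum_power_mult_eq_power_mult) (use sandwich that in auto)
  have rows: "row Mt (k * n) = row Mt (k * n + j)" if "j < n" for k j
    using arg_cong[OF shift[OF that, of k], of "\<lambda>A. row A 0"]
    by (simp add: row_M0_mult row_matY_power_mult)
  have it: "mscale (dcoef d a k) (Mt * matY ^ (k * n - 1) * Mt) =
      mscale (e ^ k) (matY ^ (k * n) * Mt) - mscale ((- a) ^ k) (Mt * matY ^ (k * n))" if "k \<ge> 1" for k
    unfolding e by (rule quadratic_relation_iterated[OF rel]) (use n that in auto)
  have step: "mscale (dcoef d a k + e ^ k) (matY ^ (k * n) * Mt) =
      mscale (dcoef d a k) (M * (matY ^ (k * n - 1) * Mt)) + mscale ((- a) ^ k) (Mt * matY ^ (k * n))"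
    if "k \<ge> 1" for k
  proof -
    have "matY * (matY ^ (k * n - 1) * Mt) = matY ^ (k * n) * Mt"
      using that n by (simp add: power_eq_if mult.assoc)
    then have "M * (matY ^ (k * n - 1) * Mt) = matY ^ (k * n) * Mt + Mt * matY ^ (k * n - 1) * Mt"
      by (simp add: M_eq distrib_right mult.assoc)
    then show ?thesis
      using it[OF that] by (simp add: ms.scale_right_distrib ms.scale_left_distrib)
  qed
  have nz: "dcoef d a k + e ^ k \<noteq> 0" if k: "k \<ge> 1" for k
  proof
    assume 0: "dcoef d a k + e ^ k = 0"
    have kn: "k * n \<ge> 1" using k n by simp
    \<comment> \<open>Column \<open>kn + 1\<close> is chosen because row \<open>kn - 1\<close> of \<open>Mt\<close> has already ended there, whereas
      the shifted row 0 has its entry \<open>- 1\<close> in it.\<close>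
    have "row (Mt * matY ^ (k * n)) 0 = Poly_Mapping.single (k * n) 1 - Poly_Mapping.single (k * n + 1) 1"
      by (simp add: row_mult_matY_power row_T0 lin_ext_diff add.commute del: single_one)
    then have 1: "entry (Mt * matY ^ (k * n)) 0 (k * n + 1) = - 1"
      by (simp add: entry_def lookup_minus lookup_single)
    have "row (M * (matY ^ (k * n - 1) * Mt)) 0 = row Mt (k * n - 1)"
      using row_M0_mult[of 1] by (simp add: row_matY_power_mult)
    then have 2: "entry (M * (matY ^ (k * n - 1) * Mt)) 0 (k * n + 1) = 0"
      using M kn by (simp add: matrix_of_twisting_map_def assms(3) entry_def row_diff row_matY
          lookup_minus lookup_single)
    have "0 = mscale (dcoef d a k) (M * (matY ^ (k * n - 1) * Mt)) + mscale ((- a) ^ k) (Mt * matY ^ (k * n))"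
      using step[OF k] by (simp add: 0)
    from arg_cong[OF this, of "\<lambda>A. entry A 0 (k * n + 1)"] have "(- a) ^ k = 0"
      using 1 2 by (simp add: entry_def row_add row_mscale lookup_add row_zero)
    then have a: "a = 0" by simp
    obtain m where m: "k = Suc m" using k by (cases k) auto
    have "dcoef d a k + e ^ k = e ^ m"
      by (simp add: m dcoef_Suc a e flip: distrib_right)
    with 0 have "e = 0" by simp
    with a assms(5) e show False by simp
  qed
  \<comment> \<open>The ratio of successive coefficients \<open>c\<^sub>k\<^sub>,\<^sub>i\<close> for fixed \<open>i\<close>.\<close>
  define r where "r k = dcoef d a k / (dcoef d a k + e ^ k)" for k
  have rec: "matY ^ (k * n) * Mt = mscale (r k) (M ^ n * (matY ^ ((k - 1) * n) * Mt))
      + mscale ((- a) ^ k / (dcoef d a k + e ^ k)) (Mt * matY ^ (k * n))" if k: "k \<ge> 1" for k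
  proof -
    have kn: "k * n - 1 = (k - 1) * n + (n - 1)"
      using k n by (cases k) auto
    have "M ^ (n - 1) * (matY ^ ((k - 1) * n) * Mt) = matY ^ ((k - 1) * n + (n - 1)) * Mt"
      by (rule shift) (use n in simp)
    then have "M * (matY ^ (k * n - 1) * Mt) = M ^ Suc (n - 1) * (matY ^ ((k - 1) * n) * Mt)"
      by (simp only: kn power_Suc mult.assoc)
    then have "mscale (dcoef d a k + e ^ k) (matY ^ (k * n) * Mt) =
      mscale (dcoef d a k) (M ^ n * (matY ^ ((k - 1) * n) * Mt)) + mscale ((- a) ^ k) (Mt * matY ^ (k * n))"
      using step[OF k] n by simp
    then have "mscale (inverse (dcoef d a k + e ^ k)) (mscale (dcoef d a k + e ^ k) (matY ^ (k * n) * Mt)) =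
      mscale (inverse (dcoef d a k + e ^ k)) (mscale (dcoef d a k) (M ^ n * (matY ^ ((k - 1) * n) * Mt)) + mscale ((- a) ^ k) (Mt * matY ^ (k * n)))"
      by simp
    then show ?thesis
      using nz[OF k] by (simp add: r_def ms.scale_right_distrib divide_inverse mult.commute)
  qed
  have c_step: "ccoef d a (Suc k) i = r (Suc k) * ccoef d a k i" if "i \<le> k" "k \<ge> 1" for i k
    using that by (simp add: ccoef_def r_def e)
  have c_diag: "ccoef d a k k = (- a) ^ k / (dcoef d a k + e ^ k)" if "k \<ge> 1" for k
    using that by (simp add: ccoef_def e)
  have "matY ^ (k * n) * Mt =
       (\<Sum>i=0..k. mscale (ccoef d a k i) (M ^ ((k - i) * n) * Mt * matY ^ (i * n)))" if "k \<ge> 1" for k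
    using that
  proof (induction k rule: nat_induct_at_least)
    case base
    \<comment> \<open>Here \<open>d\<^sub>1 + e = 1\<close>; the product defining \<open>c\<^sub>k\<^sub>,\<^sub>0\<close> starts at 2 for this reason.\<close>
    have "r 1 = ccoef d a 1 0" by (simp add: r_def ccoef_def dcoef_1 e del: One_nat_def)
    then show ?case using rec[of 1] c_diag[of 1] by simp
  next
    case (Suc k)
    have "mscale (r (Suc k)) (M ^ n * (matY ^ (k * n) * Mt)) =
      (\<Sum>i=0..k. mscale (ccoef d a (Suc k) i) (M ^ ((Suc k - i) * n) * Mt * matY ^ (i * n)))"
      unfolding Suc.IH sum_distrib_left ms.scale_sum_right
      by (intro sum.cong refl)
        (use Suc.hyps in \<open>simp add: c_step mscale_mult_right Suc_diff_le power_add mult.assoc\<close>)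
    then show ?case
      using rec[of "Suc k"] c_diag[of "Suc k"] by (simp del: mult_Suc)
  qed
  then show ?thesis using nz rows by blast
qed

end
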